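(* Consider the contract design problem (P): maximize $$\sum_{n=1}^{N}\sum_{k=1}^{K}\pi_{kn}\bigl(U(\gamma_k)-t_k\bigr)$$ over all menus $(\gamma_k,t_k)_{k=1}^K$ with $\gamma_k\ge 0$ and $t_k\in\mathbb{R}$, subject to the individual rationality constraints $$t_k-\frac{c\gamma_k}{\delta_k}\ge 0\quad\text{for all }k\in\{1,\dots,K\}\qquad(\mathrm{IR}_k)$$ and the incentive compatibility constraints $$t_k-\frac{c\gamma_k}{\delta_k}\ge t_j-\frac{c\gamma_j}{\delta_k}\quad\text{for all }k,j\in\{1,\dots,K\}\qquad(\mathrm{IC}_{k,j}).$$ Then the individual rationality constraint of the lowest type is binding at the optimum, i.e. every optimal solution of (P) satisfies $$t_1-\frac{c\gamma_1}{\delta_1}=0,$$ and the other individual rationality constraints can be ignored, i.e. every menu with $\gamma_k\ge 0$ for all $k$ that satisfies all the constraints $(\mathrm{IC}_{k,j})$ and $(\mathrm{IR}_1)$ also satisfies $(\mathrm{IR}_k)$ for every $k$.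
   Context: $N\ge 1$ (number of subcarriers) and $K\ge 1$ (number of relay types) are integers. The relay types are real numbers $0<\delta_1<\delta_2<\cdots<\delta_K$. The constant $c>0$ is the cost per unit power, and a relay of type $\delta$ providing SNR $\gamma\ge0$ incurs cost $c\gamma/\delta$. For each subcarrier $n\in\{1,\dots,N\}$, $(\pi_{1n},\dots,\pi_{Kn})$ is a probability vector: $\pi_{kn}\ge 0$ and $\sum_{k=1}^K\pi_{kn}=1$. $U:[0,\infty)\to\mathbb{R}$ is a concave function (the source's utility of SNR; the model example is $U(\gamma)=\tfrac12\log_2(1+\gamma)$). A contract $(\gamma_k,t_k)$ consists of an SNR $\gamma_k$ and a transfer $t_k$ intended for type $\delta_k$. An optimal solution of (P) is a feasible menu attaining the maximum of the objective over all feasible menus. *)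

theory Defs
  imports "HOL-Analysis.Analysis"
begin

text \<open>
  Relay types and contract items are indexed by \<open>{1..K}\<close>, subcarriers by \<open>{1..N}\<close>. A menu is a
  pair of functions \<open>\<gamma>\<close>, \<open>t\<close> on the naturals; only their values on \<open>{1..K}\<close> are ever used.
\<close>

definition relay_cost :: "real \<Rightarrow> real \<Rightarrow> real \<Rightarrow> real" where
  "relay_cost c d g = c * g / d"

definition IR :: "real \<Rightarrow> (nat \<Rightarrow> real) \<Rightarrow> (nat \<Rightarrow> real) \<Rightarrow> (nat \<Rightarrow> real) \<Rightarrow> nat \<Rightarrow> bool" where
  "IR c \<delta> \<gamma> t k \<longleftrightarrow> t k - relay_cost c (\<delta> k) (\<gamma> k) \<ge> 0"

definition IC :: "real \<Rightarrow> (nat \<Rightarrow> real) \<Rightarrow> (nat \<Rightarrow> real) \<Rightarrow> (nat \<Rightarrow> real) \<Rightarrow> nat \<Rightarrow> nat \<Rightarrow> bool" where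
  "IC c \<delta> \<gamma> t k j \<longleftrightarrow>
     t k - relay_cost c (\<delta> k) (\<gamma> k) \<ge> t j - relay_cost c (\<delta> k) (\<gamma> j)"

definition feasible ::
  "nat \<Rightarrow> real \<Rightarrow> (nat \<Rightarrow> real) \<Rightarrow> (nat \<Rightarrow> real) \<Rightarrow> (nat \<Rightarrow> real) \<Rightarrow> bool" where
  "feasible K c \<delta> \<gamma> t \<longleftrightarrow>
     (\<forall>k\<in>{1..K}. \<gamma> k \<ge> 0) \<and>
     (\<forall>k\<in>{1..K}. IR c \<delta> \<gamma> t k) \<and>
     (\<forall>k\<in>{1..K}. \<forall>j\<in>{1..K}. IC c \<delta> \<gamma> t k j)"

definition objective ::
  "nat \<Rightarrow> nat \<Rightarrow> (nat \<Rightarrow> nat \<Rightarrow> real) \<Rightarrow> (real \<Rightarrow> real) \<Rightarrow> (nat \<Rightarrow> real) \<Rightarrow> (nat \<Rightarrow> real) \<Rightarrow> real"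
  where
  "objective N K \<pi> U \<gamma> t = (\<Sum>n=1..N. \<Sum>k=1..K. \<pi> k n * (U (\<gamma> k) - t k))"

definition optimal ::
  "nat \<Rightarrow> nat \<Rightarrow> real \<Rightarrow> (nat \<Rightarrow> real) \<Rightarrow> (nat \<Rightarrow> nat \<Rightarrow> real) \<Rightarrow> (real \<Rightarrow> real)
     \<Rightarrow> (nat \<Rightarrow> real) \<Rightarrow> (nat \<Rightarrow> real) \<Rightarrow> bool" where
  "optimal N K c \<delta> \<pi> U \<gamma> t \<longleftrightarrow>
     feasible K c \<delta> \<gamma> t \<and>
     (\<forall>\<gamma>' t'. feasible K c \<delta> \<gamma>' t' \<longrightarrow>
        objective N K \<pi> U \<gamma>' t' \<le> objective N K \<pi> U \<gamma> t)"

end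

(*
  The lowest type's contract costs any other type no more than it costs the lowest type, so
  incentive compatibility towards that contract lifts individual rationality from type 1 to
  all types. If type 1 had positive rent, subtracting that rent from every transfer would
  preserve all constraints and raise the objective by N times the rent.
*)
theory Submission
  imports Defs
begin

lemma relay_cost_antimono:
  assumes "0 \<le> c" "0 \<le> g" "0 < d" "d \<le> d'"
  shows "relay_cost c d' g \<le> relay_cost c d g"
  unfolding relay_cost_def using assms by (intro divide_left_mono) auto

text \<open>Type \<open>k\<close> can imitate type \<open>j\<close>: by \<open>IC\<close> its own
  rent is at least \<open>t j - relay_cost c (\<delta> k) (\<gamma> j)\<close>, and since
  \<open>\<delta> j \<le> \<delta> k\<close> this is at least the rent of type \<open>j\<close>,
  which is nonnegative.\<close>

lemma IR_if_IC_less_efficient: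
  assumes "IC c \<delta> \<gamma> t k j" "IR c \<delta> \<gamma> t j"
    and "0 \<le> c" "0 \<le> \<gamma> j" "0 < \<delta> j" "\<delta> j \<le> \<delta> k"
  shows "IR c \<delta> \<gamma> t k"
  using assms relay_cost_antimono[of c "\<gamma> j" "\<delta> j" "\<delta> k"]
  by (auto simp: IC_def IR_def)

lemma IR_all_if_IR_lowest:
  assumes "0 < c" "0 < \<delta> 1" "strict_mono_on {1..K} \<delta>"
    and "\<forall>k\<in>{1..K}. 0 \<le> \<gamma> k"
    and "\<forall>k\<in>{1..K}. \<forall>j\<in>{1..K}. IC c \<delta> \<gamma> t k j"
    and "IR c \<delta> \<gamma> t 1"
  shows "\<forall>k\<in>{1..K}. IR c \<delta> \<gamma> t k"
proof
  fix k assume k: "k \<in> {1..K}"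
  then have 1: "1 \<in> {1..K}" by simp
  have "\<delta> 1 \<le> \<delta> k"
    using k 1 strict_mono_on_leD[OF assms(3)] by simp
  then show "IR c \<delta> \<gamma> t k"
    using assms k 1 by (intro IR_if_IC_less_efficient[of c \<delta> \<gamma> t k 1]) auto
qed

text \<open>The common shift cancels between the two sides of each comparison. Equating the
  predicates themselves covers all pairs of types at once.\<close>

lemma IC_shift: "IC c \<delta> \<gamma> (\<lambda>k. t k - e) = IC c \<delta> \<gamma> t"
  by (simp add: fun_eq_iff IC_def)

text \<open>The weights of each subcarrier sum to one, so each of the \<open>N\<close> subcarriers
  gains exactly \<open>e\<close>.\<close>

lemma objective_shift:
  assumes "\<And>n. n \<in> {1..N} \<Longrightarrow> (\<Sum>k=1..K. \<pi> k n) = 1"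
  shows "objective N K \<pi> U \<gamma> (\<lambda>k. t k - e) = objective N K \<pi> U \<gamma> t + real N * e"
proof -
  have "(\<Sum>k=1..K. \<pi> k n * (U (\<gamma> k) - (t k - e))) = (\<Sum>k=1..K. \<pi> k n * (U (\<gamma> k) - t k)) + e"
    if "n \<in> {1..N}" for n
  proof -
    have "(\<Sum>k=1..K. \<pi> k n * (U (\<gamma> k) - (t k - e)))
        = (\<Sum>k=1..K. \<pi> k n * (U (\<gamma> k) - t k)) + (\<Sum>k=1..K. \<pi> k n) * e"
      \<comment> \<open>The first \<open>simp\<close> merges the right-hand side into a single sum
        over \<open>k\<close>; the second compares the summands.\<close>
      by (simp add: sum_distrib_right flip: sum.distrib) (simp add: algebra_simps)
    then show ?thesis using assms[OF that] by simp
  qed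
  then show ?thesis
    by (simp add: objective_def sum.distrib)
qed

theorem theorem1:
  fixes N K :: nat and c :: real and \<delta> :: "nat \<Rightarrow> real"
    and \<pi> :: "nat \<Rightarrow> nat \<Rightarrow> real" and U :: "real \<Rightarrow> real"
  assumes "N \<ge> 1" and "K \<ge> 1" and "c > 0"
    and "0 < \<delta> 1" and "strict_mono_on {1..K} \<delta>"
    and "\<And>k n. k \<in> {1..K} \<Longrightarrow> n \<in> {1..N} \<Longrightarrow> \<pi> k n \<ge> 0"
    and "\<And>n. n \<in> {1..N} \<Longrightarrow> (\<Sum>k=1..K. \<pi> k n) = 1"
    and "concave_on {0..} U"
  shows "(\<forall>\<gamma> t. optimal N K c \<delta> \<pi> U \<gamma> t \<longrightarrow> t 1 - relay_cost c (\<delta> 1) (\<gamma> 1) = 0) \<and>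
    (\<forall>\<gamma> t. (\<forall>k\<in>{1..K}. \<gamma> k \<ge> 0) \<and>
       (\<forall>k\<in>{1..K}. \<forall>j\<in>{1..K}. IC c \<delta> \<gamma> t k j) \<and> IR c \<delta> \<gamma> t 1 \<longrightarrow>
       (\<forall>k\<in>{1..K}. IR c \<delta> \<gamma> t k))"
proof (intro conjI allI impI)
  fix \<gamma> t :: "nat \<Rightarrow> real"
  assume opt: "optimal N K c \<delta> \<pi> U \<gamma> t"
  \<comment> \<open>The rent of type 1 is the largest uniform cut in transfers that still respects
    its individual rationality.\<close>
  define e where "e = t 1 - relay_cost c (\<delta> 1) (\<gamma> 1)"
  have feas: "feasible K c \<delta> \<gamma> t" using opt by (simp add: optimal_def)
  then have "0 \<le> e" using \<open>K \<ge> 1\<close> by (auto simp: feasible_def IR_def e_def)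
  have IR1: "IR c \<delta> \<gamma> (\<lambda>k. t k - e) 1" by (simp add: IR_def e_def)
  \<comment> \<open>Lower transfers could break \<open>IR\<close> for the higher types, so it is not
    inherited from the old menu but rederived from \<open>IR1\<close> and the unchanged
    \<open>IC\<close>.\<close>
  have "feasible K c \<delta> \<gamma> (\<lambda>k. t k - e)"
    using feas IR_all_if_IR_lowest[OF assms(3-5) _ _ IR1]
    by (simp add: feasible_def IC_shift)
  then have "objective N K \<pi> U \<gamma> (\<lambda>k. t k - e) \<le> objective N K \<pi> U \<gamma> t"
    using opt by (simp add: optimal_def)
  then have "real N * e \<le> 0"
    using objective_shift[where \<pi> = \<pi>, OF assms(7)] by simp
  then have "e \<le> 0" using \<open>N \<ge> 1\<close> by (simp add: mult_le_0_iff)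
  with \<open>0 \<le> e\<close> show "t 1 - relay_cost c (\<delta> 1) (\<gamma> 1) = 0" by (simp add: e_def)
next
  fix \<gamma> t :: "nat \<Rightarrow> real"
  assume "(\<forall>k\<in>{1..K}. \<gamma> k \<ge> 0) \<and>
    (\<forall>k\<in>{1..K}. \<forall>j\<in>{1..K}. IC c \<delta> \<gamma> t k j) \<and> IR c \<delta> \<gamma> t 1"
  then show "\<forall>k\<in>{1..K}. IR c \<delta> \<gamma> t k"
    using IR_all_if_IR_lowest[OF assms(3-5)] by blast
qed

end
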